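(* Let $M\ge 0$ be an integer and let $H$ be a Hamiltonian on a finite-dimensional complex Hilbert space with spectral decomposition $$H=\sum_{m=0}^{M} m\sum_{\alpha=1}^{\Delta_m}|m,\alpha\rangle\langle m,\alpha|,$$ where the vectors $|m,\alpha\rangle$ ($0\le m\le M$, $1\le\alpha\le\Delta_m$) form an orthonormal basis and $\alpha$ labels the $\Delta_m$-fold degeneracy of the eigenvalue $m$. Let $L^{+}$ and $L^{-}=(L^{+})^{\dagger}$ be ladder operators, i.e. linear operators satisfying $$L^{\pm}|m,\alpha\rangle=c^{\pm}_{m,\alpha}\,|m\pm1,\alpha\rangle,\qquad c^{\pm}_{m,\alpha}\in\mathbb{R},\qquad c^{-}_{0,\alpha}=c^{+}_{M,\alpha}=0,$$ where $L^{\pm}|m,\alpha\rangle=0$ (that is, $c^{\pm}_{m,\alpha}=0$) whenever there is no basis vector $|m\pm1,\alpha\rangle$. Let $\beta\ge 0$ and let $\rho=e^{-\beta H}/Z$ with $Z=\operatorname{Tr}e^{-\beta H}$ be the Gibbs state. Then for $A=L^{+}+L^{-}$ and $B=i(L^{+}-L^{-})$, $$(\Delta A)^2_{\rho}\;\mathcal{F}_{\rho}(B)=\langle i[A,B]\rangle_{\rho}^2 .$$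
   Context: For a density operator $\rho$ and an operator $X$, $\langle X\rangle_\rho=\operatorname{Tr}(\rho X)$; for self-adjoint $A$, $(\Delta A)^2_\rho=\langle A^2\rangle_\rho-\langle A\rangle_\rho^2$. $[A,B]=AB-BA$. The quantum Fisher information of $\rho$ with respect to a self-adjoint operator $B$ (the generator of the evolution $\rho\mapsto e^{-iB\theta}\rho e^{iB\theta}$) is defined, for a spectral decomposition $\rho=\sum_i q_i|\psi_i\rangle\langle\psi_i|$ with $(\psi_i)$ an orthonormal basis, by $$\mathcal{F}_\rho(B)=2\sum_{i,j:\;q_i+q_j>0}\frac{(q_i-q_j)^2}{q_i+q_j}\,|\langle\psi_i|B|\psi_j\rangle|^2 .$$ The general inequality $(\Delta A)^2_\rho\,\mathcal{F}_\rho(B)\ge\langle i[A,B]\rangle_\rho^2$ holds for all self-adjoint $A,B$; the claim is that it is saturated. *)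

theory Defs
  imports "HOL-Analysis.Analysis"
begin

text \<open>
  The Hilbert space is \<open>complex ^ 'n\<close> with its standard Hermitian inner product
  (conjugate-linear in the first argument), and operators are matrices \<open>complex ^ 'n ^ 'n\<close>.
  The library's \<open>\<bullet>\<close> and \<open>span\<close> are the real ones; here the complex-valued \<open>cinner\<close> and the complex
  span \<open>vec.span\<close> are needed.
\<close>

definition cinner :: "complex ^ 'n \<Rightarrow> complex ^ 'n \<Rightarrow> complex"
  where "cinner x y = (\<Sum>k\<in>UNIV. cnj (x $ k) * y $ k)"

definition ketbra :: "complex ^ 'n \<Rightarrow> complex ^ 'n \<Rightarrow> complex ^ 'n ^ 'n"
  where "ketbra x y = (\<chi> k l. x $ k * cnj (y $ l))"

definition dagger :: "complex ^ 'n ^ 'n \<Rightarrow> complex ^ 'n ^ 'n"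
  where "dagger A = (\<chi> k l. cnj (A $ l $ k))"

definition orthonormal_basis :: "'i set \<Rightarrow> ('i \<Rightarrow> complex ^ 'n) \<Rightarrow> bool"
  where "orthonormal_basis I e \<longleftrightarrow>
    (\<forall>i\<in>I. \<forall>j\<in>I. cinner (e i) (e j) = (if i = j then 1 else 0)) \<and> vec.span (e ` I) = UNIV"

definition cscale :: "complex \<Rightarrow> complex ^ 'n ^ 'n \<Rightarrow> complex ^ 'n ^ 'n"  (infixr "*\<^sub>C" 75)
  where "c *\<^sub>C A = (\<chi> k l. c * A $ k $ l)"

definition commutator :: "complex ^ 'n ^ 'n \<Rightarrow> complex ^ 'n ^ 'n \<Rightarrow> complex ^ 'n ^ 'n"
  where "commutator A B = A ** B - B ** A"

text \<open>
  Powers of matrices must be taken with respect to \<open>**\<close>: the library's \<open>*\<close> and \<open>^\<close> on vectors and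
  matrices are componentwise.
\<close>

definition matrix_exp :: "complex ^ 'n ^ 'n \<Rightarrow> complex ^ 'n ^ 'n"
  where "matrix_exp A = (\<Sum>k. (1 / fact k) *\<^sub>R (((**) A ^^ k) (mat 1)))"

definition gibbs_state :: "real \<Rightarrow> complex ^ 'n ^ 'n \<Rightarrow> complex ^ 'n ^ 'n"
  where "gibbs_state \<beta> H =
    (1 / trace (matrix_exp ((- \<beta>) *\<^sub>R H))) *\<^sub>C matrix_exp ((- \<beta>) *\<^sub>R H)"

definition expectation :: "complex ^ 'n ^ 'n \<Rightarrow> complex ^ 'n ^ 'n \<Rightarrow> complex"
  where "expectation \<rho> X = trace (\<rho> ** X)"

definition variance :: "complex ^ 'n ^ 'n \<Rightarrow> complex ^ 'n ^ 'n \<Rightarrow> complex"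
  where "variance \<rho> A = expectation \<rho> (A ** A) - (expectation \<rho> A)\<^sup>2"

definition level_index :: "nat \<Rightarrow> (nat \<Rightarrow> nat) \<Rightarrow> (nat \<times> nat) set"
  where "level_index M \<Delta> = {(m, \<alpha>). m \<le> M \<and> 1 \<le> \<alpha> \<and> \<alpha> \<le> \<Delta> m}"

definition spectral_decomposition ::
    "complex ^ 'n ^ 'n \<Rightarrow> ('n \<Rightarrow> real) \<Rightarrow> ('n \<Rightarrow> complex ^ 'n) \<Rightarrow> bool"
  where "spectral_decomposition \<rho> q \<psi> \<longleftrightarrow>
    orthonormal_basis UNIV \<psi> \<and> \<rho> = (\<Sum>i\<in>UNIV. q i *\<^sub>R ketbra (\<psi> i) (\<psi> i))"

definition fisher_sum ::
    "('n \<Rightarrow> real) \<Rightarrow> ('n \<Rightarrow> complex ^ 'n) \<Rightarrow> complex ^ 'n ^ 'n \<Rightarrow> real"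
  where "fisher_sum q \<psi> B =
    2 * (\<Sum>(i, j) \<in> {(i, j). q i + q j > 0}.
           (q i - q j)\<^sup>2 / (q i + q j) * (cmod (cinner (\<psi> i) (B *v \<psi> j)))\<^sup>2)"

text \<open>
  The description is proper: by \<open>fisher_information_eq\<close> below the value does not depend on the
  spectral decomposition.
\<close>

definition fisher_information :: "complex ^ 'n ^ 'n \<Rightarrow> complex ^ 'n ^ 'n \<Rightarrow> real"
  where "fisher_information \<rho> B =
    (THE F. \<exists>q \<psi>. spectral_decomposition \<rho> q \<psi> \<and> F = fisher_sum q \<psi> B)"

lemma cinner_add_right: "cinner x (y + z) = cinner x y + cinner x z"
  by (simp add: cinner_def algebra_simps sum.distrib)

lemma cinner_scale_right: "cinner x (c *s y) = c * cinner x y"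
  by (simp add: cinner_def sum_distrib_left mult_ac)

lemma cinner_zero_right: "cinner x 0 = 0"
  by (simp add: cinner_def)

lemma cinner_cnj: "cnj (cinner x y) = cinner y x"
  by (simp add: cinner_def mult.commute)

lemma cinner_sum_right: "cinner x (\<Sum>i\<in>S. f i) = (\<Sum>i\<in>S. cinner x (f i))"
  by (induction S rule: infinite_finite_induct)
     (simp_all add: cinner_zero_right cinner_add_right)

lemma cinner_dagger: "cinner x (A *v y) = cinner (dagger A *v x) y"
proof -
  have "cinner x (A *v y) = (\<Sum>k\<in>UNIV. \<Sum>l\<in>UNIV. cnj (x $ k) * A $ k $ l * y $ l)"
    by (simp add: cinner_def matrix_vector_mult_def sum_distrib_left mult_ac)
  also have "\<dots> = (\<Sum>l\<in>UNIV. \<Sum>k\<in>UNIV. cnj (x $ k) * A $ k $ l * y $ l)"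
    by (rule sum.swap)
  also have "\<dots> = cinner (dagger A *v x) y"
    by (simp add: cinner_def dagger_def matrix_vector_mult_def sum_distrib_right sum_distrib_left mult_ac)
  finally show ?thesis .
qed

lemma parseval:
  assumes "orthonormal_basis (UNIV :: 'n::finite set) (\<psi> :: 'n \<Rightarrow> complex ^ 'n)"
  shows "cinner x y = (\<Sum>i\<in>UNIV. cinner x (\<psi> i) * cinner (\<psi> i) y)"
proof -
  have orth: "cinner (\<psi> i) (\<psi> j) = (if i = j then 1 else 0)" for i j
    using assms by (auto simp: orthonormal_basis_def)
  have "y \<in> vec.span (range \<psi>)"
    using assms by (simp add: orthonormal_basis_def)
  then show ?thesis
  proof (induction rule: vec.span_induct_alt)
    case base
    show ?case by (simp add: cinner_zero_right)
  next
    case (step c v y)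
    then obtain k where v: "v = \<psi> k" by auto
    have "(\<Sum>i\<in>UNIV. cinner x (\<psi> i) * cinner (\<psi> i) v) = cinner x v"
      by (simp add: v orth if_distrib cong: if_cong)
    then show ?case
      using step by (simp add: cinner_add_right cinner_scale_right distrib_left sum.distrib
          mult.left_commute[of _ c] flip: sum_distrib_left)
  qed
qed

lemma spectral_eigen:
  assumes "spectral_decomposition \<rho> q (\<psi> :: 'n::finite \<Rightarrow> complex ^ 'n)"
  shows "cinner x (\<rho> *v y) = (\<Sum>i\<in>UNIV. of_real (q i) * (cinner x (\<psi> i) * cinner (\<psi> i) y))"
proof -
  have sum_mv: "(\<Sum>i\<in>S. f i) *v y = (\<Sum>i\<in>S. f i *v y)" for S and f :: "'n \<Rightarrow> complex ^ 'n ^ 'n"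
    by (induction S rule: infinite_finite_induct) (simp_all add: matrix_vector_mult_add_rdistrib)
  have "(r *\<^sub>R ketbra u u) *v y = (of_real r * cinner u y) *s u" for r :: real and u :: "complex ^ 'n"
    by (simp add: vec_eq_iff ketbra_def matrix_vector_mult_def cinner_def sum_distrib_left
        scaleR_conv_of_real[where 'a = complex] mult_ac)
  then have "\<rho> *v y = (\<Sum>i\<in>UNIV. (of_real (q i) * cinner (\<psi> i) y) *s \<psi> i)"
    using assms by (simp add: spectral_decomposition_def sum_mv)
  then show ?thesis
    by (simp add: cinner_sum_right cinner_scale_right mult_ac)
qed

lemma weighted_sum_unique:
  fixes \<psi> \<phi> :: "'n::finite \<Rightarrow> complex ^ 'n" and w :: "real \<Rightarrow> real"
  assumes \<psi>: "spectral_decomposition \<rho> q \<psi>" and \<phi>: "spectral_decomposition \<rho> p \<phi>"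
  shows "(\<Sum>j\<in>UNIV. w (q j) * (cmod (cinner v (\<psi> j)))\<^sup>2)
       = (\<Sum>l\<in>UNIV. w (p l) * (cmod (cinner v (\<phi> l)))\<^sup>2)"
proof -
  note b\<psi> = \<psi>[unfolded spectral_decomposition_def, THEN conjunct1]
  note b\<phi> = \<phi>[unfolded spectral_decomposition_def, THEN conjunct1]
  have o\<psi>: "cinner (\<psi> i) (\<psi> j) = (if i = j then 1 else 0)" for i j
    using b\<psi> by (auto simp: orthonormal_basis_def)
  have o\<phi>: "cinner (\<phi> i) (\<phi> j) = (if i = j then 1 else 0)" for i j
    using b\<phi> by (auto simp: orthonormal_basis_def)
  have "of_real (q j) * cinner (\<phi> l) (\<psi> j) = of_real (p l) * cinner (\<phi> l) (\<psi> j)" for j l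
  proof -
    have "cinner (\<phi> l) (\<rho> *v \<psi> j) = of_real (q j) * cinner (\<phi> l) (\<psi> j)"
      by (simp add: spectral_eigen[OF \<psi>] o\<psi> if_distrib cong: if_cong)
    moreover have "cinner (\<phi> l) (\<rho> *v \<psi> j) = of_real (p l) * cinner (\<phi> l) (\<psi> j)"
      by (simp add: spectral_eigen[OF \<phi>] o\<phi> if_distrib if_distribR cong: if_cong)
    ultimately show ?thesis by metis
  qed
  then have "cinner (\<phi> l) (\<psi> j) = 0 \<or> q j = p l" for j l
    by (metis mult_cancel_right of_real_eq_iff)
  then have w: "of_real (w (q j)) * cinner (\<phi> l) (\<psi> j)
      = of_real (w (p l)) * cinner (\<phi> l) (\<psi> j)" for j l
    by (metis mult_zero_right)
  have sq: "complex_of_real ((cmod (cinner v u))\<^sup>2) = cinner v u * cinner u v" for u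
    by (metis cinner_cnj complex_norm_square)
  have "complex_of_real (\<Sum>j\<in>UNIV. w (q j) * (cmod (cinner v (\<psi> j)))\<^sup>2)
      = (\<Sum>j\<in>UNIV. of_real (w (q j)) * (cinner v (\<psi> j) * cinner (\<psi> j) v))"
    unfolding of_real_sum of_real_mult sq ..
  also have "\<dots> = (\<Sum>j\<in>UNIV. \<Sum>l\<in>UNIV.
      cinner v (\<phi> l) * (of_real (w (q j)) * cinner (\<phi> l) (\<psi> j)) * cinner (\<psi> j) v)"
    by (subst (1) parseval[OF b\<phi>, of v])
       (simp add: sum_distrib_left sum_distrib_right mult_ac)
  also have "\<dots> = (\<Sum>l\<in>UNIV. \<Sum>j\<in>UNIV.
      cinner v (\<phi> l) * (of_real (w (p l)) * cinner (\<phi> l) (\<psi> j)) * cinner (\<psi> j) v)"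
    unfolding w by (rule sum.swap)
  also have "\<dots> = (\<Sum>l\<in>UNIV. of_real (w (p l)) * (cinner v (\<phi> l) * cinner (\<phi> l) v))"
    by (subst (5) parseval[OF b\<psi>])
       (simp add: sum_distrib_left mult_ac)
  also have "\<dots> = complex_of_real (\<Sum>l\<in>UNIV. w (p l) * (cmod (cinner v (\<phi> l)))\<^sup>2)"
    unfolding of_real_sum of_real_mult sq ..
  finally show ?thesis
    by (simp only: of_real_eq_iff)
qed

lemma fisher_sum_unique:
  fixes \<psi> \<phi> :: "'n::finite \<Rightarrow> complex ^ 'n"
  assumes \<psi>: "spectral_decomposition \<rho> q \<psi>" and \<phi>: "spectral_decomposition \<rho> p \<phi>"
  shows "fisher_sum q \<psi> B = fisher_sum p \<phi> B"
proof -
  define g where "g = (\<lambda>x y :: real. if x + y > 0 then (x - y)\<^sup>2 / (x + y) else 0)"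
  have fs: "fisher_sum r \<eta> B
      = 2 * (\<Sum>i\<in>UNIV. \<Sum>j\<in>UNIV. g (r i) (r j) * (cmod (cinner (\<eta> i) (B *v \<eta> j)))\<^sup>2)"
    for r and \<eta> :: "'n \<Rightarrow> complex ^ 'n"
    unfolding fisher_sum_def sum.cartesian_product
    by (intro arg_cong[where f = "(*) 2"] sum.mono_neutral_cong_left)
       (auto simp: g_def split: if_splits)
  have l: "cinner (\<psi> i) (B *v u) = cinner (dagger B *v \<psi> i) u" for i u
    by (rule cinner_dagger)
  have r: "cmod (cinner x y) = cmod (cinner y x)" for x y :: "complex ^ 'n"
    by (metis cinner_cnj complex_mod_cnj)
  have "(\<Sum>i\<in>UNIV. \<Sum>j\<in>UNIV. g (q i) (q j) * (cmod (cinner (\<psi> i) (B *v \<psi> j)))\<^sup>2)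
      = (\<Sum>i\<in>UNIV. \<Sum>j\<in>UNIV. g (q i) (p j) * (cmod (cinner (\<psi> i) (B *v \<phi> j)))\<^sup>2)"
    unfolding l by (intro sum.cong refl weighted_sum_unique[OF \<psi> \<phi>])
  also have "\<dots> = (\<Sum>j\<in>UNIV. \<Sum>i\<in>UNIV. g (q i) (p j) * (cmod (cinner (B *v \<phi> j) (\<psi> i)))\<^sup>2)"
    by (subst sum.swap) (simp only: r)
  also have "\<dots> = (\<Sum>j\<in>UNIV. \<Sum>i\<in>UNIV. g (p i) (p j) * (cmod (cinner (B *v \<phi> j) (\<phi> i)))\<^sup>2)"
    by (intro sum.cong refl weighted_sum_unique[OF \<psi> \<phi>, of "\<lambda>x. g x (p _)"])
  also have "\<dots> = (\<Sum>i\<in>UNIV. \<Sum>j\<in>UNIV. g (p i) (p j) * (cmod (cinner (\<phi> i) (B *v \<phi> j)))\<^sup>2)"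
    by (subst sum.swap) (simp only: r)
  finally show ?thesis
    by (simp add: fs)
qed

lemma fisher_information_eq:
  assumes "spectral_decomposition \<rho> q \<psi>"
  shows "fisher_information \<rho> B = fisher_sum q \<psi> B"
  unfolding fisher_information_def
  using assms by (intro the_equality) (auto intro: fisher_sum_unique)

end

theory Submission
  imports Defs
begin

text \<open>
  In an eigenbasis of \<open>H\<close> the matrix elements \<open>l\<close> of \<open>L\<^sup>+\<close> satisfy \<open>l i j \<noteq> 0 \<Longrightarrow> h i = h j + 1\<close>, so that
  \<open>q i = r * q j\<close> for the Gibbs weights, where \<open>r = exp (- \<beta>)\<close>.  Each of the three quantities is
  thereby a multiple of \<open>S = Tr (\<rho> L\<^sup>- L\<^sup>+)\<close>: the variance is \<open>(1 + r) S\<close>, the Fisher information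
  \<open>4 (1 - r)\<^sup>2 / (1 + r) S\<close> and the commutator term \<open>- 2 (1 - r) S\<close>.
\<close>

section \<open>Operators diagonal in an orthonormal basis\<close>

definition spectral_sum :: "('n \<Rightarrow> complex ^ 'n) \<Rightarrow> ('n \<Rightarrow> real) \<Rightarrow> complex ^ 'n ^ 'n"
  where "spectral_sum \<psi> a = (\<Sum>i\<in>UNIV. a i *\<^sub>R ketbra (\<psi> i) (\<psi> i))"

text \<open>Standard basis vectors in the left slot read off coordinates. Operator identities thus
  reduce to scalar ones, to which \<open>spectral_eigen\<close> and \<open>parseval\<close>
  apply.\<close>

lemma matrix_eqI_cinner:
  fixes X Y :: "complex ^ 'n ^ 'n"
  assumes "\<And>x y. cinner x (X *v y) = cinner x (Y *v y)"
  shows "X = Y"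
proof -
  have "v $ k = cinner (axis k 1) v" for v :: "complex ^ 'n" and k
    by (simp add: cinner_def axis_def if_distrib[of cnj] if_distribR if_distrib[of "\<lambda>c. c * _"] cong: if_cong)
  then have "X *v y = Y *v y" for y
    using assms by (simp add: vec_eq_iff)
  then show ?thesis
    by (simp add: matrix_eq)
qed

text \<open>The identity is resolved between \<open>X\<close> and \<open>Y\<close>: once
  \<open>X\<close> is moved to the left slot as its adjoint, this is
  \<open>parseval\<close>.\<close>

lemma cinner_matrix_mult:
  fixes \<psi> :: "'n::finite \<Rightarrow> complex ^ 'n"
  assumes "orthonormal_basis UNIV \<psi>"
  shows "cinner x (((X :: complex ^ 'n ^ 'n) ** Y) *v y) = (\<Sum>j\<in>UNIV. cinner x (X *v \<psi> j) * cinner (\<psi> j) (Y *v y))"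
  using parseval[OF assms, of "dagger X *v x" "Y *v y"]
  by (simp add: cinner_dagger[of _ X] flip: matrix_vector_mul_assoc)

lemma spectral_decomposition_spectral_sum:
  "orthonormal_basis UNIV \<psi> \<Longrightarrow> spectral_decomposition (spectral_sum \<psi> a) a \<psi>"
  by (simp add: spectral_decomposition_def spectral_sum_def)

lemma spectral_sum_mult:
  fixes \<psi> :: "'n::finite \<Rightarrow> complex ^ 'n"
  assumes b: "orthonormal_basis UNIV \<psi>"
  shows "spectral_sum \<psi> a ** spectral_sum \<psi> b = spectral_sum \<psi> (\<lambda>i. a i * b i)"
proof (rule matrix_eqI_cinner)
  fix x y
  have orth: "cinner (\<psi> i) (\<psi> j) = (if i = j then 1 else 0)" for i j
    using b by (auto simp: orthonormal_basis_def)
  note e = spectral_eigen[OF spectral_decomposition_spectral_sum[OF b]]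
  have "cinner x (spectral_sum \<psi> a *v \<psi> j) = of_real (a j) * cinner x (\<psi> j)" for j
    by (simp add: e orth if_distrib cong: if_cong)
  moreover have "cinner (\<psi> j) (spectral_sum \<psi> b *v y) = of_real (b j) * cinner (\<psi> j) y" for j
    by (simp add: e orth if_distrib if_distribR cong: if_cong)
  ultimately show "cinner x ((spectral_sum \<psi> a ** spectral_sum \<psi> b) *v y)
      = cinner x (spectral_sum \<psi> (\<lambda>i. a i * b i) *v y)"
    by (simp add: cinner_matrix_mult[OF b] e mult_ac)
qed

lemma spectral_sum_one:
  fixes \<psi> :: "'n::finite \<Rightarrow> complex ^ 'n"
  assumes b: "orthonormal_basis UNIV \<psi>"
  shows "spectral_sum \<psi> (\<lambda>_. 1) = mat 1"
  by (rule matrix_eqI_cinner)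
     (simp add: spectral_eigen[OF spectral_decomposition_spectral_sum[OF b]] flip: parseval[OF b])

lemma spectral_sum_scaleR: "c *\<^sub>R spectral_sum \<psi> a = spectral_sum \<psi> (\<lambda>i. c * a i)"
  by (simp add: spectral_sum_def scaleR_right.sum)

section \<open>Expectations, exponential and Gibbs state\<close>

lemma matrix_add_rdistrib: "(A + B) ** C = A ** C + B ** (C :: 'a::semiring_1 ^ 'n ^ 'n)"
  by (simp add: vec_eq_iff matrix_matrix_mult_def distrib_right sum.distrib)

lemma trace_ketbra_mult: "trace (ketbra x y ** X) = cinner y (X *v x)"
proof -
  have "trace (ketbra x y ** X) = (\<Sum>k\<in>UNIV. \<Sum>l\<in>UNIV. cnj (y $ l) * (X $ l $ k * x $ k))"
    by (simp add: trace_def matrix_matrix_mult_def ketbra_def mult_ac)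
  also have "\<dots> = cinner y (X *v x)"
    by (subst sum.swap) (simp add: cinner_def matrix_vector_mult_def sum_distrib_left)
  finally show ?thesis .
qed

lemma expectation_spectral_sum:
  "expectation (spectral_sum \<psi> a) X = (\<Sum>i\<in>UNIV. of_real (a i) * cinner (\<psi> i) (X *v \<psi> i))"
proof -
  have sum_mm: "(\<Sum>i\<in>S. f i) ** X = (\<Sum>i\<in>S. f i ** X)" for S and f :: "'a \<Rightarrow> complex ^ 'a ^ 'a"
    by (induction S rule: infinite_finite_induct) (simp_all add: matrix_add_rdistrib)
  have tr_sum: "trace (\<Sum>i\<in>S. f i) = (\<Sum>i\<in>S. trace (f i))" for S and f :: "'a \<Rightarrow> complex ^ 'a ^ 'a"
    by (induction S rule: infinite_finite_induct) (simp_all add: trace_add trace_0[unfolded mat_0])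
  have tr_scale: "trace ((r *\<^sub>R K) ** X) = of_real r * trace (K ** X)" for r and K :: "complex ^ 'a ^ 'a"
    by (simp add: trace_def matrix_matrix_mult_def sum_distrib_left
        scaleR_conv_of_real[where 'a = complex] mult_ac)
  show ?thesis
    by (simp add: expectation_def spectral_sum_def sum_mm tr_sum tr_scale trace_ketbra_mult)
qed

text \<open>Powers act on the eigenvalues, so the matrix series is a finite combination of fixed
  projectors whose coefficients are scalar exponential series.\<close>

lemma matrix_exp_spectral_sum:
  fixes \<psi> :: "'n::finite \<Rightarrow> complex ^ 'n"
  assumes b: "orthonormal_basis UNIV \<psi>"
  shows "matrix_exp (spectral_sum \<psi> a) = spectral_sum \<psi> (\<lambda>i. exp (a i))"
proof -
  have pow: "(((**) (spectral_sum \<psi> a) ^^ k) (mat 1)) = spectral_sum \<psi> (\<lambda>i. a i ^ k)" for k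
    by (induction k) (simp_all add: spectral_sum_one[OF b] spectral_sum_mult[OF b])
  have "(\<lambda>k. \<Sum>i\<in>UNIV. (a i ^ k /\<^sub>R fact k) *\<^sub>R ketbra (\<psi> i) (\<psi> i))
      sums (\<Sum>i\<in>UNIV. exp (a i) *\<^sub>R ketbra (\<psi> i) (\<psi> i))"
    by (intro sums_sum bounded_linear.sums[OF bounded_linear_scaleR_left] exp_converges)
  then have "(\<lambda>k. (1 / fact k) *\<^sub>R (((**) (spectral_sum \<psi> a) ^^ k) (mat 1)))
      sums spectral_sum \<psi> (\<lambda>i. exp (a i))"
    unfolding pow spectral_sum_scaleR by (simp add: spectral_sum_def field_simps)
  then show ?thesis
    unfolding matrix_exp_def by (rule sums_unique[symmetric])
qed

lemma gibbs_state_spectral_sum: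
  fixes \<psi> :: "'n::finite \<Rightarrow> complex ^ 'n"
  assumes b: "orthonormal_basis UNIV \<psi>"
  shows "gibbs_state \<beta> (spectral_sum \<psi> h)
    = spectral_sum \<psi> (\<lambda>i. exp (- \<beta> * h i) / (\<Sum>j\<in>UNIV. exp (- \<beta> * h j)))"
proof -
  have 1: "cinner (\<psi> i) (\<psi> i) = 1" for i
    using b by (auto simp: orthonormal_basis_def)
  \<comment> \<open>A trace is the expectation of \<open>mat 1\<close>, and each basis vector has
    norm one.\<close>
  have "trace (spectral_sum \<psi> a) = of_real (\<Sum>j\<in>UNIV. a j)" for a
    using expectation_spectral_sum[of \<psi> a "mat 1"] by (simp add: expectation_def 1)
  moreover have "(1 / of_real c) *\<^sub>C X = (1 / c) *\<^sub>R X" for c and X :: "complex ^ 'n ^ 'n"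
    by (simp add: cscale_def vec_eq_iff scaleR_conv_of_real[where 'a = complex])
  ultimately show ?thesis
    by (simp only: gibbs_state_def spectral_sum_scaleR matrix_exp_spectral_sum[OF b]) simp
qed

section \<open>Size of an orthonormal basis\<close>

lemma inj_on_orthonormal_basis: "orthonormal_basis I e \<Longrightarrow> inj_on e I"
  unfolding orthonormal_basis_def inj_on_def by (metis zero_neq_one)

text \<open>Orthonormal vectors are independent. The count allows a basis over any index set to be
  relabelled by \<open>'n\<close>, the index type that \<open>spectral_decomposition\<close>
  demands.\<close>

lemma card_orthonormal_basis:
  fixes e :: "'i \<Rightarrow> complex ^ 'n"
  assumes b: "orthonormal_basis I e"
  shows "card I = CARD('n)"
proof -
  have "vec.independent (e ` I)"
    unfolding vec.dependent_def
  proof safe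
    fix i
    assume i: "i \<in> I" and s: "e i \<in> vec.span (e ` I - {e i})"
    \<comment> \<open>The span of the other vectors is orthogonal to \<open>e i\<close>, whereas
      \<open>cinner (e i) (e i) = 1\<close>.\<close>
    have "cinner (e i) z = 0" if "z \<in> vec.span (e ` I - {e i})" for z
      using that
    proof (induction rule: vec.span_induct_alt)
      case base
      show ?case by (simp add: cinner_zero_right)
    next
      case (step c v y)
      then obtain k where "v = e k" "k \<in> I" "k \<noteq> i" by auto
      then have "cinner (e i) v = 0"
        using b i by (auto simp: orthonormal_basis_def)
      then show ?case
        using step by (simp add: cinner_add_right cinner_scale_right)
    qed
    from this[OF s] show False
      using b i by (auto simp: orthonormal_basis_def)
  qed
  then have "card (e ` I) = vec.dim (vec.span (e ` I))"
    by (metis vec.dim_eq_card_independent vec.dim_span)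
  also have "\<dots> = CARD('n)"
    using b by (simp add: orthonormal_basis_def card_cart_basis del: vec.dim_span)
  finally show ?thesis
    by (simp add: card_image[OF inj_on_orthonormal_basis[OF b]])
qed

section \<open>Saturation of the inequality\<close>

text \<open>The ladder structure enters as the selection rule \<open>raise\<close>, for a basis
  indexed by \<open>'n\<close>.\<close>

lemma saturation_eigenbasis:
  fixes \<psi> :: "'n::finite \<Rightarrow> complex ^ 'n" and h :: "'n \<Rightarrow> real"
  assumes b: "orthonormal_basis UNIV \<psi>"
    and raise: "\<And>i j. cinner (\<psi> i) (L *v \<psi> j) \<noteq> 0 \<Longrightarrow> h i = h j + 1"
    and \<rho>: "\<rho> = gibbs_state \<beta> (spectral_sum \<psi> h)"
    and A: "A = L + dagger L"
    and B: "B = \<i> *\<^sub>C (L - dagger L)"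
  shows "variance \<rho> A * of_real (fisher_information \<rho> B)
       = (expectation \<rho> (\<i> *\<^sub>C commutator A B))\<^sup>2"
proof -
  define r where "r = exp (- \<beta>)"
  define q where "q i = exp (- \<beta> * h i) / (\<Sum>j\<in>UNIV. exp (- \<beta> * h j))" for i
  define l where "l i j = cinner (\<psi> i) (L *v \<psi> j)" for i j
  define S where "S = (\<Sum>i\<in>UNIV. \<Sum>j\<in>UNIV. q j * (cmod (l i j))\<^sup>2)"
  have \<rho>_q: "\<rho> = spectral_sum \<psi> q"
    unfolding \<rho> gibbs_state_spectral_sum[OF b] q_def ..
  have Z: "(\<Sum>j\<in>UNIV. exp (- \<beta> * h j)) > 0"
    by (intro sum_pos) auto
  have q_pos: "q i > 0" for i
    unfolding q_def using Z by (intro divide_pos_pos) auto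
  have r: "r > 0" by (simp add: r_def)
  have shift: "q i = r * q j" if "l i j \<noteq> 0" for i j
    using raise[of i j] that by (simp add: l_def q_def r_def algebra_simps flip: exp_add)
  \<comment> \<open>Two nonzero entries would give \<open>h i = h i + 2\<close>.\<close>
  have asym: "l i j = 0 \<or> l j i = 0" for i j
    using raise[of i j] raise[of j i] unfolding l_def by linarith
  have diag: "l i i = 0" for i
    using asym by blast
  have dag: "cinner (\<psi> i) (dagger L *v \<psi> j) = cnj (l j i)" for i j
    by (metis cinner_cnj cinner_dagger l_def)
  note el = cinner_matrix_mult[OF b] dag l_def[symmetric] cinner_add_right
  have E_add: "expectation \<rho> (X + Y) = expectation \<rho> X + expectation \<rho> Y" for X Y
    by (simp add: \<rho>_q expectation_spectral_sum matrix_vector_mult_add_rdistrib cinner_add_right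
        sum.distrib distrib_left)
  have E_scale: "expectation \<rho> (c *\<^sub>C X) = c * expectation \<rho> X" for c X
  proof -
    have "(c *\<^sub>C X) *v v = c *s (X *v v)" for v
      by (simp add: vec_eq_iff cscale_def matrix_vector_mult_def sum_distrib_left mult_ac)
    then show ?thesis
      by (simp add: \<rho>_q expectation_spectral_sum cinner_scale_right sum_distrib_left mult_ac)
  qed
  have E_L: "expectation \<rho> L = 0" "expectation \<rho> (dagger L) = 0"
    by (simp_all add: \<rho>_q expectation_spectral_sum el diag)
  \<comment> \<open>Every summand contains a product of \<open>l i j\<close> and
    \<open>l j i\<close>, or of their conjugates.\<close>
  have E_LL: "expectation \<rho> (L ** L) = 0" "expectation \<rho> (dagger L ** dagger L) = 0"
    using asym by (auto simp: \<rho>_q expectation_spectral_sum el intro!: sum.neutral)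
  have E_dL: "expectation \<rho> (dagger L ** L) = of_real S"
  proof -
    have "expectation \<rho> (dagger L ** L) = (\<Sum>j\<in>UNIV. \<Sum>i\<in>UNIV. of_real (q j * (cmod (l i j))\<^sup>2))"
      by (simp add: \<rho>_q expectation_spectral_sum el sum_distrib_left complex_norm_square mult_ac
          del: of_real_power)
    also have "\<dots> = of_real S"
      unfolding S_def by (subst sum.swap) simp
    finally show ?thesis .
  qed
  have E_Ld: "expectation \<rho> (L ** dagger L) = of_real (r * S)"
  proof -
    have "expectation \<rho> (L ** dagger L) = (\<Sum>i\<in>UNIV. \<Sum>j\<in>UNIV. of_real (q i * (cmod (l i j))\<^sup>2))"
      by (simp add: \<rho>_q expectation_spectral_sum el sum_distrib_left complex_norm_square mult_ac
          del: of_real_power)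
    also have "\<dots> = (\<Sum>i\<in>UNIV. \<Sum>j\<in>UNIV. of_real (r * (q j * (cmod (l i j))\<^sup>2)))"
      \<comment> \<open>Where \<open>l i j = 0\<close>, \<open>shift\<close> says nothing, but both
        summands vanish.\<close>
      by (intro sum.cong refl) (metis shift mult.assoc mult_zero_right norm_zero zero_power2)
    finally show ?thesis
      by (simp add: S_def sum_distrib_left)
  qed
  have var: "variance \<rho> A = of_real ((1 + r) * S)"
    unfolding variance_def A
    by (simp add: E_add E_L E_LL E_dL E_Ld matrix_add_ldistrib matrix_add_rdistrib algebra_simps)
  \<comment> \<open>The two factors \<open>\<i>\<close> give \<open>-1\<close>; the squares of
    \<open>L\<close> and of \<open>dagger L\<close> cancel, and each mixed product occurs
    twice.\<close>
  have "\<i> *\<^sub>C commutator A B = 2 *\<^sub>C (L ** dagger L) + (- 2) *\<^sub>C (dagger L ** L)"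
    by (simp add: commutator_def A B cscale_def vec_eq_iff matrix_matrix_mult_def algebra_simps
        sum.distrib sum_subtractf sum_distrib_left sum_negf)
  then have com: "expectation \<rho> (\<i> *\<^sub>C commutator A B) = of_real (- 2 * (1 - r) * S)"
    by (simp add: E_add E_scale E_dL E_Ld algebra_simps)
  have B_el: "(cmod (cinner (\<psi> i) (B *v \<psi> j)))\<^sup>2 = (cmod (l i j))\<^sup>2 + (cmod (l j i))\<^sup>2" for i j
  proof -
    have "B *v v = \<i> *s (L *v v) + (- \<i>) *s (dagger L *v v)" for v
      by (simp add: vec_eq_iff B cscale_def matrix_vector_mult_def sum_distrib_left
          algebra_simps sum_subtractf)
    then have "cinner (\<psi> i) (B *v \<psi> j) = \<i> * l i j - \<i> * cnj (l j i)"
      by (simp only: cinner_add_right cinner_scale_right dag l_def) simp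
    \<comment> \<open>By \<open>asym\<close> at most one of the two terms is nonzero, so there is no
      interference.\<close>
    then show ?thesis
      using asym[of i j] by (auto simp: norm_mult)
  qed
  define g where "g i j = (q i - q j)\<^sup>2 / (q i + q j)" for i j
  have g: "g i j * (cmod (l i j))\<^sup>2 = (1 - r)\<^sup>2 / (1 + r) * (q j * (cmod (l i j))\<^sup>2)" for i j
  proof (cases "l i j = 0")
    case False
    \<comment> \<open>Here \<open>q i - q j = - (1 - r) * q j\<close>; the square removes the
      sign.\<close>
    have "g i j = (q j * (1 - r))\<^sup>2 / (q j * (1 + r))"
      by (simp add: g_def shift[OF False] power2_commute algebra_simps)
    also have "\<dots> = (1 - r)\<^sup>2 / (1 + r) * q j"
      using q_pos[of j] r by (simp add: power_mult_distrib power2_eq_square)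
    finally show ?thesis by simp
  qed simp
  have "fisher_information \<rho> B = fisher_sum q \<psi> B"
    unfolding \<rho>_q by (intro fisher_information_eq spectral_decomposition_spectral_sum b)
  \<comment> \<open>Gibbs weights are positive, so the restriction \<open>q i + q j > 0\<close>
    excludes no pair.\<close>
  also have "\<dots> = 2 * (\<Sum>i\<in>UNIV. \<Sum>j\<in>UNIV. g i j * ((cmod (l i j))\<^sup>2 + (cmod (l j i))\<^sup>2))"
    using q_pos by (simp add: fisher_sum_def B_el g_def add_pos_pos sum.cartesian_product)
  also have "\<dots> = 2 * ((\<Sum>i\<in>UNIV. \<Sum>j\<in>UNIV. g i j * (cmod (l i j))\<^sup>2)
                    + (\<Sum>j\<in>UNIV. \<Sum>i\<in>UNIV. g j i * (cmod (l i j))\<^sup>2))"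
    by (simp add: distrib_left sum.distrib)
  \<comment> \<open>\<open>g\<close> is symmetric, so raising and lowering terms contribute
    equally.\<close>
  also have "\<dots> = 4 * (\<Sum>i\<in>UNIV. \<Sum>j\<in>UNIV. g i j * (cmod (l i j))\<^sup>2)"
  proof -
    have "g j i = g i j" for i j
      by (simp add: g_def power2_commute add.commute)
    then show ?thesis
      by (subst (2) sum.swap) simp
  qed
  also have "\<dots> = 4 * ((1 - r)\<^sup>2 / (1 + r) * S)"
    by (simp add: g S_def sum_distrib_left)
  finally have fisher: "fisher_information \<rho> B = 4 * ((1 - r)\<^sup>2 / (1 + r) * S)" .
  \<comment> \<open>The factor \<open>1 + r\<close> of the variance cancels the denominator of the
    Fisher information.\<close>
  have "(1 + r) * S * (4 * ((1 - r)\<^sup>2 / (1 + r) * S)) = (- 2 * (1 - r) * S)\<^sup>2"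
    using r by (simp add: power2_eq_square) (simp add: algebra_simps)
  then show ?thesis
    unfolding var fisher com by (metis of_real_mult of_real_power)
qed

text \<open>Relabelling the levels by \<open>'n\<close> reduces the claim to
  \<open>saturation_eigenbasis\<close>. Outside the index set \<open>ket\<close> is arbitrary, and
  \<open>m - 1\<close> is \<open>0\<close> at \<open>m = 0\<close>; the vanishing coefficients make
  the ladder operators zero at these ends.\<close>

theorem mainTheorem1:
  fixes M :: nat and \<Delta> :: "nat \<Rightarrow> nat"
    and ket :: "nat \<times> nat \<Rightarrow> complex ^ 'n"
    and H Lp Lm A B \<rho> :: "complex ^ 'n ^ 'n"
    and cp cm :: "nat \<Rightarrow> nat \<Rightarrow> real"
    and \<beta> :: real
  assumes basis: "orthonormal_basis (level_index M \<Delta>) ket"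
    and H: "H = (\<Sum>m = 0..M. real m *\<^sub>R (\<Sum>\<alpha> = 1..\<Delta> m. ketbra (ket (m, \<alpha>)) (ket (m, \<alpha>))))"
    and adj: "Lm = dagger Lp"
    and Lp: "\<And>m \<alpha>. (m, \<alpha>) \<in> level_index M \<Delta> \<Longrightarrow> Lp *v ket (m, \<alpha>) = of_real (cp m \<alpha>) *s ket (m + 1, \<alpha>)"
    and Lm: "\<And>m \<alpha>. (m, \<alpha>) \<in> level_index M \<Delta> \<Longrightarrow> Lm *v ket (m, \<alpha>) = of_real (cm m \<alpha>) *s ket (m - 1, \<alpha>)"
    and cp_zero: "\<And>m \<alpha>. (m, \<alpha>) \<in> level_index M \<Delta> \<Longrightarrow> m = M \<or> (m + 1, \<alpha>) \<notin> level_index M \<Delta> \<Longrightarrow> cp m \<alpha> = 0"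
    and cm_zero: "\<And>m \<alpha>. (m, \<alpha>) \<in> level_index M \<Delta> \<Longrightarrow> m = 0 \<or> (m - 1, \<alpha>) \<notin> level_index M \<Delta> \<Longrightarrow> cm m \<alpha> = 0"
    and \<beta>: "\<beta> \<ge> 0"
    and \<rho>: "\<rho> = gibbs_state \<beta> H"
    and A: "A = Lp + Lm"
    and B: "B = \<i> *\<^sub>C (Lp - Lm)"
  shows "variance \<rho> A * of_real (fisher_information \<rho> B)
       = (expectation \<rho> (\<i> *\<^sub>C commutator A B))\<^sup>2"
proof -
  let ?I = "level_index M \<Delta>"
  \<comment> \<open>An infinite set has \<open>card\<close> zero, but \<open>CARD('n)\<close> is
    positive.\<close>
  have fin: "finite ?I"
    using card_orthonormal_basis[OF basis] card.infinite by fastforce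
  obtain f :: "'n \<Rightarrow> nat \<times> nat" where f: "bij_betw f UNIV ?I"
    using finite_same_card_bij[OF finite fin] card_orthonormal_basis[OF basis] by metis
  define \<psi> where "\<psi> = ket \<circ> f"
  define h where "h i = real (fst (f i))" for i
  have f_in: "f i \<in> ?I" for i
    using f by (auto simp: bij_betw_def)
  have f_eq: "f i = f j \<longleftrightarrow> i = j" for i j
    using f by (auto simp: bij_betw_def inj_def)
  have orth: "cinner (ket x) (ket y) = (if x = y then 1 else 0)" if "x \<in> ?I" "y \<in> ?I" for x y
    using basis that by (auto simp: orthonormal_basis_def)
  have b: "orthonormal_basis UNIV \<psi>"
    using basis f_eq f_in orth bij_betw_imp_surj_on[OF f]
    unfolding orthonormal_basis_def \<psi>_def image_comp[symmetric] by simp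
  have I: "?I = Sigma {0..M} (\<lambda>m. {1..\<Delta> m})"
    by (auto simp: level_index_def)
  have "H = (\<Sum>(m, \<alpha>)\<in>?I. real m *\<^sub>R ketbra (ket (m, \<alpha>)) (ket (m, \<alpha>)))"
    unfolding H I by (subst sum.Sigma[symmetric]) (simp_all add: scaleR_right.sum)
  also have "\<dots> = (\<Sum>x\<in>?I. real (fst x) *\<^sub>R ketbra (ket x) (ket x))"
    by (simp add: case_prod_beta)
  also have "\<dots> = spectral_sum \<psi> h"
    unfolding spectral_sum_def \<psi>_def h_def comp_def
    by (rule sum.reindex_bij_betw[OF f, symmetric])
  finally have H_h: "H = spectral_sum \<psi> h" .
  have raise: "h i = h j + 1" if nz: "cinner (\<psi> i) (Lp *v \<psi> j) \<noteq> 0" for i j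
  proof -
    obtain m \<alpha> where j: "f j = (m, \<alpha>)" by fastforce
    have mem: "(m, \<alpha>) \<in> ?I" using f_in[of j] j by simp
    have el: "cinner (\<psi> i) (Lp *v \<psi> j) = of_real (cp m \<alpha>) * cinner (ket (f i)) (ket (m + 1, \<alpha>))"
      by (simp add: \<psi>_def j Lp[OF mem] cinner_scale_right)
    \<comment> \<open>Otherwise \<open>cp_zero\<close> would make the matrix element vanish. Only
      with membership does orthonormality apply to \<open>ket (m + 1, \<alpha>)\<close>, which then
      forces the value of \<open>f i\<close>.\<close>
    with nz have "(m + 1, \<alpha>) \<in> ?I"
      using cp_zero[OF mem] by fastforce
    with nz el have "f i = (m + 1, \<alpha>)"
      using orth[OF f_in] by (metis mult_zero_right)
    then show ?thesis
      by (simp add: h_def j)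
  qed
  show ?thesis
    by (rule saturation_eigenbasis[OF b raise \<rho>[unfolded H_h] A[unfolded adj] B[unfolded adj]])
qed

end
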